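(* Let $\mathbf{B}$ be a real separable Banach space and let $X$ be a $\mathbf{B}$-valued random variable such that $X \in \mathrm{CLTSS}$ and $X \notin \mathrm{CLT}$. Let $X_1, X_2, \dots$ be i.i.d. copies of $X$ and $S_n = \sum_{i=1}^n X_i$. Then, for any sequence $\{a_n; n \in \mathbb{N}\}$ of positive real numbers, $(S_n/a_n)_{n \in \mathbb{N}}$ does not converge weakly to a non-degenerate probability measure on $\mathbf{B}$.
   Context: $(\mathbf{B},\|\cdot\|)$ is a real separable Banach space with its Borel $\sigma$-algebra. A $\mathbf{B}$-valued random variable is a measurable map from a (complete, sufficiently rich) probability space into $\mathbf{B}$. $\mathbb{N}$ is the set of positive integers; a subsequence $\{m_n; n\in\mathbb{N}\}$ of $\mathbb{N}$ is a strictly increasing sequence of positive integers. With $X_1,X_2,\dots$ i.i.d. copies of $X$ and $S_n=\sum_{i=1}^n X_i$: $X \in \mathrm{CLT}$ means that $(S_n/\sqrt{n})_{n \in \mathbb{N}}$ converges weakly (in distribution, to some $\mathbf{B}$-valued random variable); $X \in \mathrm{CLTSS}$ means that there exists a subsequence $\{m_n; n \in \mathbb{N}\}$ of $\mathbb{N}$ such that $(S_{m_n}/\sqrt{m_n})_{n \in \mathbb{N}}$ converges weakly (to some $\mathbf{B}$-valued random variable). A probability measure on $\mathbf{B}$ is non-degenerate if it is not concentrated at a single point. *)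

theory Defs
  imports "HOL-Probability.Probability"
begin

text \<open>
  Weak convergence of Borel measures, tested against bounded continuous real functions
  (the library's \<^const>\<open>weak_conv_m\<close> is restricted to measures on the real line).
  Separable Banach spaces are types of class \<^class>\<open>banach\<close> and
  \<^class>\<open>second_countable_topology\<close>; for metric spaces, second countable means separable.
\<close>

definition weakly_converges :: "(nat \<Rightarrow> 'b::topological_space measure) \<Rightarrow> 'b measure \<Rightarrow> bool" where
  "weakly_converges \<mu> \<nu> \<longleftrightarrow>
     (\<forall>f :: 'b \<Rightarrow> real. continuous_on UNIV f \<and> bounded (range f) \<longrightarrow>
        (\<lambda>n. \<integral>x. f x \<partial>\<mu> n) \<longlonglongrightarrow> (\<integral>x. f x \<partial>\<nu>))"

definition borel_prob :: "'b::topological_space measure \<Rightarrow> bool" where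
  "borel_prob \<nu> \<longleftrightarrow> prob_space \<nu> \<and> sets \<nu> = sets borel"

definition nondegenerate :: "'b::topological_space measure \<Rightarrow> bool" where
  "nondegenerate \<nu> \<longleftrightarrow> \<not> (\<exists>x. measure \<nu> {x} = 1)"

text \<open>
  Sequences of random variables are indexed by the positive integers; the value at index
  0 is never used.
\<close>

definition iid_copies :: "'a measure \<Rightarrow> ('a \<Rightarrow> 'b::topological_space) \<Rightarrow> (nat \<Rightarrow> 'a \<Rightarrow> 'b) \<Rightarrow> bool" where
  "iid_copies M X Xs \<longleftrightarrow>
     prob_space.indep_vars M (\<lambda>_. borel) Xs {1..} \<and>
     (\<forall>i\<ge>1. distr M borel (Xs i) = distr M borel X)"

definition psum :: "(nat \<Rightarrow> 'a \<Rightarrow> 'b::comm_monoid_add) \<Rightarrow> nat \<Rightarrow> 'a \<Rightarrow> 'b" where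
  "psum Xs n \<omega> = (\<Sum>i=1..n. Xs i \<omega>)"

definition scaled_law :: "'a measure \<Rightarrow> (nat \<Rightarrow> 'a \<Rightarrow> 'b::real_normed_vector) \<Rightarrow> (nat \<Rightarrow> real) \<Rightarrow> nat \<Rightarrow> 'b measure" where
  "scaled_law M Xs a n = distr M borel (\<lambda>\<omega>. psum Xs n \<omega> /\<^sub>R a n)"

text \<open>
  The laws of the partial sums depend only on the law of \<open>X\<close>, so the choice of i.i.d. copies
  below is immaterial; \<open>M\<close> must be rich enough to carry at least one such sequence.
  The limiting random variable is represented by its law \<open>\<nu>\<close>.
\<close>

definition CLT :: "'a measure \<Rightarrow> ('a \<Rightarrow> 'b::real_normed_vector) \<Rightarrow> bool" where
  "CLT M X \<longleftrightarrow>
     (\<exists>Xs. iid_copies M X Xs \<and>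
        (\<exists>\<nu>. borel_prob \<nu> \<and> weakly_converges (scaled_law M Xs (\<lambda>n. sqrt (real n))) \<nu>))"

definition CLTSS :: "'a measure \<Rightarrow> ('a \<Rightarrow> 'b::real_normed_vector) \<Rightarrow> bool" where
  "CLTSS M X \<longleftrightarrow>
     (\<exists>Xs. iid_copies M X Xs \<and>
        (\<exists>m :: nat \<Rightarrow> nat. strict_mono m \<and> (\<forall>n. m n \<ge> 1) \<and>
          (\<exists>\<nu>. borel_prob \<nu> \<and>
             weakly_converges (\<lambda>n. scaled_law M Xs (\<lambda>k. sqrt (real k)) (m n)) \<nu>)))"

end

theory Submission
  imports Defs
begin

text \<open>
  By Hahn-Banach and separability, a non-degenerate limit \<open>\<nu>\<close> of \<open>S\<^sub>n / a\<^sub>n\<close> has a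
  non-degenerate image under some continuous functional \<open>f\<close>. Let \<open>\<phi>\<close> be the characteristic
  function of \<open>f(X)\<close>. Tightness along the CLTSS subsequence gives
  \<open>1 - |\<phi>(s)|\<^sup>2 \<le> C s\<^sup>2\<close> for a sequence \<open>s \<rightarrow> 0\<close>, so by Fatou the difference of two independent
  copies of \<open>f(X)\<close> has finite second moment \<open>2\<sigma>\<close>, and then \<open>(1 - |\<phi>(s)|\<^sup>2) / s\<^sup>2 \<rightarrow> \<sigma>\<close> as
  \<open>s \<rightarrow> 0\<close>. Comparing with \<open>|\<phi>(t/a\<^sub>n)|\<^sup>2\<^sup>n \<rightarrow> h\<close>, where \<open>0 < h < 1\<close> at a suitable \<open>t\<close>, forces
  \<open>n / a\<^sub>n\<^sup>2\<close> to converge to a positive number. Hence \<open>S\<^sub>n / \<surd>n = (a\<^sub>n / \<surd>n) S\<^sub>n / a\<^sub>n\<close> converges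
  weakly, that is \<open>X \<in> CLT\<close>. Working with \<open>|\<phi>|\<^sup>2\<close> avoids any centering.
\<close>

subsection \<open>Weak convergence with a convergent parameter\<close>

text \<open>For bounded \<open>G\<close> and \<open>k \<ge> 0\<close> this is the largest
  \<open>k\<close>-Lipschitz minorant of \<open>G\<close> (the Pasch-Hausdorff envelope).\<close>

definition inf_convolution :: "('m::metric_space \<Rightarrow> real) \<Rightarrow> real \<Rightarrow> 'm \<Rightarrow> real" where
  "inf_convolution G k x = (INF y. G y + k * dist x y)"

context
  fixes G :: "'m::metric_space \<Rightarrow> real" and k B :: real
  assumes k: "k \<ge> 0" and B: "\<And>x. \<bar>G x\<bar> \<le> B"
begin

lemma bdd_below_inf_convolution: "bdd_below (range (\<lambda>y. G y + k * dist x y))"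
proof (rule bdd_belowI2)
  fix y show "- B \<le> G y + k * dist x y"
    using B[of y] k by (smt (verit) mult_nonneg_nonneg zero_le_dist)
qed

lemma inf_convolution_le: "inf_convolution G k x \<le> G y + k * dist x y"
  unfolding inf_convolution_def by (rule cINF_lower[OF bdd_below_inf_convolution]) simp

lemma inf_convolution_ge: "(\<And>y. c \<le> G y + k * dist x y) \<Longrightarrow> c \<le> inf_convolution G k x"
  unfolding inf_convolution_def by (rule cINF_greatest) auto

lemma inf_convolution_bound: "\<bar>inf_convolution G k x\<bar> \<le> B"
proof -
  have "- B \<le> inf_convolution G k x"
  proof (rule inf_convolution_ge)
    fix y show "- B \<le> G y + k * dist x y"
      using B[of y] k by (smt (verit) mult_nonneg_nonneg zero_le_dist)
  qed
  moreover have "inf_convolution G k x \<le> B"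
    using inf_convolution_le[of x x] B[of x] by simp
  ultimately show ?thesis by linarith
qed

lemma inf_convolution_diff_le: "inf_convolution G k x - k * dist x x' \<le> inf_convolution G k x'"
proof (rule inf_convolution_ge)
  fix y
  have "k * dist x y \<le> k * dist x x' + k * dist x' y"
    using mult_left_mono[OF dist_triangle[of x y x'] k] by (simp add: algebra_simps)
  then show "inf_convolution G k x - k * dist x x' \<le> G y + k * dist x' y"
    using inf_convolution_le[of x y] by linarith
qed

lemma inf_convolution_lipschitz: "k-lipschitz_on UNIV (inf_convolution G k)"
proof (rule lipschitz_onI[OF _ k])
  fix x x'
  show "dist (inf_convolution G k x) (inf_convolution G k x') \<le> k * dist x x'"
    using inf_convolution_diff_le[of x x'] inf_convolution_diff_le[of x' x]
    by (simp add: dist_real_def dist_commute abs_le_iff)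
qed

end

text \<open>Points near \<open>x\<close> cannot lower the infimum by more than \<open>e / 2\<close>,
  by continuity. Points at distance at least \<open>d\<close> pay a penalty \<open>k * d\<close>,
  which exceeds the oscillation \<open>2 * B\<close> once \<open>k > 2 * B / d\<close>.\<close>

lemma inf_convolution_tendsto:
  fixes G :: "'m::metric_space \<Rightarrow> real"
  assumes B: "\<And>x. \<bar>G x\<bar> \<le> B" and G: "isCont G x"
  shows "(\<lambda>k. inf_convolution G (real k) x) \<longlonglongrightarrow> G x"
proof (rule LIMSEQ_I)
  fix e :: real assume e: "e > 0"
  obtain d where d: "d > 0" "\<And>y. dist y x < d \<Longrightarrow> dist (G y) (G x) < e / 2"
    using G e by (metis continuous_at_eps_delta half_gt_zero)
  obtain k0 :: nat where k0: "2 * B / d < real k0" using reals_Archimedean2 by blast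
  have "norm (inf_convolution G (real k) x - G x) < e" if k: "k \<ge> k0" for k
  proof -
    have "G x - e / 2 \<le> inf_convolution G (real k) x"
    proof (rule inf_convolution_ge[OF _ B])
      fix y
      show "G x - e / 2 \<le> G y + real k * dist x y"
      proof (cases "dist y x < d")
        case True
        then show ?thesis using d(2)[OF True]
          by (smt (verit) dist_real_def mult_nonneg_nonneg of_nat_0_le_iff zero_le_dist)
      next
        case False
        have "2 * B \<le> real k * d" using k0 k d(1)
          by (smt (verit) of_nat_mono pos_divide_less_eq mult_right_mono)
        also have "\<dots> \<le> real k * dist x y"
          using False by (intro mult_left_mono) (auto simp: dist_commute)
        finally show ?thesis using B[of x] B[of y] e by linarith
      qed
    qed auto
    moreover have "inf_convolution G (real k) x \<le> G x"
      using inf_convolution_le[OF _ B, where k = "real k" and x = x and y = x] by simp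
    ultimately show ?thesis using e by simp
  qed
  then show "\<exists>k0. \<forall>k\<ge>k0. norm (inf_convolution G (real k) x - G x) < e" by blast
qed

lemma borel_prob_integrable:
  fixes F :: "'b::topological_space \<Rightarrow> real"
  assumes M: "borel_prob M" and F: "continuous_on UNIV F" "\<And>x. \<bar>F x\<bar> \<le> B"
  shows "integrable M F"
proof -
  interpret prob_space M using M by (simp add: borel_prob_def)
  show ?thesis
  proof (rule integrable_const_bound[of _ B])
    show "F \<in> borel_measurable M"
      using borel_measurable_continuous_onI[OF F(1)] M
      by (metis borel_prob_def measurable_cong_sets)
  qed (use F in auto)
qed

lemma weakly_convergesD:
  fixes F :: "'b::topological_space \<Rightarrow> real"
  assumes "weakly_converges \<mu> \<nu>" "continuous_on UNIV F" "\<And>x. \<bar>F x\<bar> \<le> B"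
  shows "(\<lambda>n. \<integral>x. F x \<partial>\<mu> n) \<longlonglongrightarrow> (\<integral>x. F x \<partial>\<nu>)"
proof -
  have "bounded (range F)" using assms(3) by (auto simp: bounded_iff)
  then show ?thesis using assms unfolding weakly_converges_def by blast
qed

text \<open>Regularising \<open>F\<close> jointly in both arguments makes it uniformly continuous in the parameter,
  so no tightness is needed.\<close>

lemma weakly_converges_param_liminf:
  fixes F :: "'u::metric_space \<times> 'b::metric_space \<Rightarrow> real"
  assumes \<mu>: "\<And>n. borel_prob (\<mu> n)" and \<nu>: "borel_prob \<nu>" and conv: "weakly_converges \<mu> \<nu>"
    and u: "u \<longlonglongrightarrow> l" and F: "continuous_on UNIV F" and B: "\<And>z. \<bar>F z\<bar> \<le> B" and e: "e > 0"
  shows "eventually (\<lambda>n. (\<integral>x. F (l, x) \<partial>\<nu>) - e < (\<integral>x. F (u n, x) \<partial>\<mu> n)) sequentially"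
proof -
  interpret \<nu>: prob_space \<nu> using \<nu> by (simp add: borel_prob_def)
  have sets_\<nu>: "sets \<nu> = sets borel" using \<nu> by (simp add: borel_prob_def)
  define H where "H k = inf_convolution F (real k)" for k :: nat
  have H_bound: "\<bar>H k z\<bar> \<le> B" for k z
    unfolding H_def by (rule inf_convolution_bound[OF _ B]) simp
  have H_cont: "continuous_on UNIV (\<lambda>x. H k (v, x))" for k v
    unfolding H_def
    by (rule continuous_on_compose2[OF lipschitz_on_continuous_on[OF inf_convolution_lipschitz[OF _ B]]])
       (auto intro!: continuous_intros)
  have F_cont: "continuous_on UNIV (\<lambda>x. F (v, x))" for v
    by (rule continuous_on_compose2[OF F]) (auto intro!: continuous_intros)
  have meas: "g \<in> borel_measurable \<nu>" if "continuous_on UNIV g" for g :: "'b \<Rightarrow> real"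
    using borel_measurable_continuous_onI[OF that] measurable_cong_sets[OF sets_\<nu> refl] by blast
  \<comment> \<open>Dominated convergence under the limit measure alone fixes one \<open>k\<close>,
    at a cost of \<open>e / 2\<close>. Only afterwards does \<open>n\<close> tend to
    infinity.\<close>
  have "(\<lambda>k. \<integral>x. H k (l, x) \<partial>\<nu>) \<longlonglongrightarrow> (\<integral>x. F (l, x) \<partial>\<nu>)"
  proof (rule integral_dominated_convergence[where w="\<lambda>_. B"])
    show "AE x in \<nu>. (\<lambda>k. H k (l, x)) \<longlonglongrightarrow> F (l, x)"
      unfolding H_def using F
      by (intro AE_I2 inf_convolution_tendsto[OF B]) (auto simp: continuous_on_eq_continuous_at)
  qed (use H_bound in \<open>auto intro!: meas H_cont F_cont\<close>)
  from order_tendstoD(1)[OF this, of "(\<integral>x. F (l, x) \<partial>\<nu>) - e / 2"]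
  obtain k where k: "(\<integral>x. F (l, x) \<partial>\<nu>) - e / 2 < (\<integral>x. H k (l, x) \<partial>\<nu>)"
    using e by (auto simp: eventually_sequentially)
  \<comment> \<open>With \<open>k\<close> fixed, replacing the parameter \<open>l\<close> by
    \<open>u n\<close> changes \<open>H k\<close> by at most \<open>k * dist l (u n)\<close>,
    uniformly in \<open>x\<close>, and this error vanishes in the limit.\<close>
  have "(\<lambda>n. (\<integral>x. H k (l, x) \<partial>\<mu> n) - real k * dist l (u n)) \<longlonglongrightarrow> (\<integral>x. H k (l, x) \<partial>\<nu>) - real k * dist l l"
    by (intro tendsto_intros weakly_convergesD[OF conv H_cont H_bound] u)
  from order_tendstoD(1)[OF this, of "(\<integral>x. F (l, x) \<partial>\<nu>) - e"]
  have "eventually (\<lambda>n. (\<integral>x. F (l, x) \<partial>\<nu>) - e < (\<integral>x. H k (l, x) \<partial>\<mu> n) - real k * dist l (u n)) sequentially"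
    using k e by simp
  then show ?thesis
  proof eventually_elim
    case (elim n)
    interpret prob_space "\<mu> n" using \<mu> by (simp add: borel_prob_def)
    have int: "integrable (\<mu> n) (\<lambda>x. H k (l, x))" "integrable (\<mu> n) (\<lambda>x. F (u n, x))"
      by (auto intro!: borel_prob_integrable[OF \<mu>] H_cont F_cont H_bound B)
    have "(\<integral>x. H k (l, x) \<partial>\<mu> n) - real k * dist l (u n) = (\<integral>x. H k (l, x) - real k * dist l (u n) \<partial>\<mu> n)"
      using int by (simp add: prob_space)
    also have "\<dots> \<le> (\<integral>x. F (u n, x) \<partial>\<mu> n)"
    proof (rule integral_mono)
      fix x
      have "H k (l, x) - real k * dist (l, x) (u n, x) \<le> H k (u n, x)"
        unfolding H_def by (rule inf_convolution_diff_le[OF _ B]) simp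
      moreover have "H k (u n, x) \<le> F (u n, x)"
        unfolding H_def using inf_convolution_le[OF _ B, where k = "real k" and x = "(u n, x)" and y = "(u n, x)"] by simp
      moreover have "dist (l, x) (u n, x) = dist l (u n)" by (simp add: dist_Pair_Pair)
      ultimately show "H k (l, x) - real k * dist l (u n) \<le> F (u n, x)" by simp
    qed (use int in auto)
    finally show ?case using elim by linarith
  qed
qed

text \<open>The missing upper bound is the lower bound for \<open>- F\<close>.\<close>

lemma weakly_converges_param:
  fixes F :: "'u::metric_space \<times> 'b::metric_space \<Rightarrow> real"
  assumes \<mu>: "\<And>n. borel_prob (\<mu> n)" and \<nu>: "borel_prob \<nu>" and conv: "weakly_converges \<mu> \<nu>"
    and u: "u \<longlonglongrightarrow> l" and F: "continuous_on UNIV F" and B: "\<And>z. \<bar>F z\<bar> \<le> B"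
  shows "(\<lambda>n. \<integral>x. F (u n, x) \<partial>\<mu> n) \<longlonglongrightarrow> (\<integral>x. F (l, x) \<partial>\<nu>)"
proof (rule LIMSEQ_I)
  fix e :: real assume e: "e > 0"
  have "eventually (\<lambda>n. \<bar>(\<integral>x. F (u n, x) \<partial>\<mu> n) - (\<integral>x. F (l, x) \<partial>\<nu>)\<bar> < e) sequentially"
    using weakly_converges_param_liminf[OF \<mu> \<nu> conv u F B e]
      weakly_converges_param_liminf[OF \<mu> \<nu> conv u continuous_on_minus[OF F] _ e, of B] B
    by (auto simp: abs_less_iff elim: eventually_elim2)
  then show "\<exists>no. \<forall>n\<ge>no. norm ((\<integral>x. F (u n, x) \<partial>\<mu> n) - (\<integral>x. F (l, x) \<partial>\<nu>)) < e"
    by (simp add: eventually_sequentially)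
qed

text \<open>The parameter is the scalar: the test function \<open>f\<close> is composed with scalar
  multiplication, which is jointly continuous. This turns a limit law for \<open>S_n / a_n\<close>
  into one for \<open>S_n / sqrt n\<close>.\<close>

lemma weakly_converges_scaleR:
  fixes \<mu> :: "nat \<Rightarrow> 'b::real_normed_vector measure"
  assumes \<mu>: "\<And>n. borel_prob (\<mu> n)" and \<nu>: "borel_prob \<nu>" and conv: "weakly_converges \<mu> \<nu>"
    and c: "c \<longlonglongrightarrow> l"
  shows "weakly_converges (\<lambda>n. distr (\<mu> n) borel (\<lambda>x. c n *\<^sub>R x)) (distr \<nu> borel (\<lambda>x. l *\<^sub>R x))"
  unfolding weakly_converges_def
proof (intro allI impI, elim conjE)
  fix f :: "'b \<Rightarrow> real" assume f: "continuous_on UNIV f" "bounded (range f)"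
  obtain B where B: "\<And>x. \<bar>f x\<bar> \<le> B" using f(2) by (auto simp: bounded_iff)
  have m: "(\<lambda>x. r *\<^sub>R x) \<in> measurable N borel" if "borel_prob N" for N :: "'b measure" and r
    using that measurable_cong_sets[of N borel borel borel]
      borel_measurable_continuous_onI[of "\<lambda>x::'b. r *\<^sub>R x"]
    by (auto simp: borel_prob_def intro!: continuous_intros)
  have "(\<lambda>n. \<integral>x. (\<lambda>z. f (fst z *\<^sub>R snd z)) (c n, x) \<partial>\<mu> n) \<longlonglongrightarrow> (\<integral>x. (\<lambda>z. f (fst z *\<^sub>R snd z)) (l, x) \<partial>\<nu>)"
    by (rule weakly_converges_param[OF \<mu> \<nu> conv c])
       (use B in \<open>auto intro!: continuous_on_compose2[OF f(1)] continuous_intros\<close>)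
  then show "(\<lambda>n. \<integral>x. f x \<partial>distr (\<mu> n) borel (\<lambda>x. c n *\<^sub>R x)) \<longlonglongrightarrow> (\<integral>x. f x \<partial>distr \<nu> borel (\<lambda>x. l *\<^sub>R x))"
    using m[OF \<mu>] m[OF \<nu>] borel_measurable_continuous_onI[OF f(1)] by (simp add: integral_distr)
qed

subsection \<open>Norming functionals\<close>

definition sublinear :: "('v::real_vector \<Rightarrow> real) \<Rightarrow> bool" where
  "sublinear q \<longleftrightarrow> (\<forall>x y. q (x + y) \<le> q x + q y) \<and> (\<forall>r x. r \<ge> 0 \<longrightarrow> q (r *\<^sub>R x) = r * q x)"

lemma sublinear_add: "sublinear q \<Longrightarrow> q (x + y) \<le> q x + q y"
  and sublinear_scaleR: "sublinear q \<Longrightarrow> r \<ge> 0 \<Longrightarrow> q (r *\<^sub>R x) = r * q x"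
  by (auto simp: sublinear_def)

lemma sublinear_zero: "sublinear q \<Longrightarrow> q 0 = 0"
  using sublinear_scaleR[of q 0 0] by simp

lemma sublinear_minus: "sublinear q \<Longrightarrow> - q (- x) \<le> q x"
  using sublinear_add[of q x "- x"] by (simp add: sublinear_zero)

text \<open>If \<open>q\<close> is minimal among sublinear functionals then \<open>tilt q y = q\<close>; taking \<open>t = 1\<close> in the
  infimum yields \<open>q x + q y \<le> q (x + y)\<close>, so \<open>q\<close> is additive.\<close>

definition tilt :: "('v::real_vector \<Rightarrow> real) \<Rightarrow> 'v \<Rightarrow> 'v \<Rightarrow> real" where
  "tilt q y x = (INF t\<in>{0..}. q (x + t *\<^sub>R y) - t * q y)"

lemma bdd_below_tilt:
  assumes "sublinear q"
  shows "bdd_below ((\<lambda>t. q (x + t *\<^sub>R y) - t * q y) ` {0..})"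
proof (rule bdd_belowI2)
  fix t :: real assume t: "t \<in> {0..}"
  have "q (t *\<^sub>R y) \<le> q (x + t *\<^sub>R y) + q (- x)"
    using sublinear_add[OF assms, of "x + t *\<^sub>R y" "- x"] by simp
  then show "- q (- x) \<le> q (x + t *\<^sub>R y) - t * q y"
    using sublinear_scaleR[OF assms, of t y] t by simp
qed

lemma tilt_le:
  assumes "sublinear q" "t \<ge> 0"
  shows "tilt q y x \<le> q (x + t *\<^sub>R y) - t * q y"
  unfolding tilt_def by (rule cINF_lower[OF bdd_below_tilt[OF assms(1)]]) (use assms in simp)

lemma tilt_ge: "(\<And>t. t \<ge> 0 \<Longrightarrow> c \<le> q (x + t *\<^sub>R y) - t * q y) \<Longrightarrow> c \<le> tilt q y x"
  unfolding tilt_def by (rule cINF_greatest) auto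

lemma tilt_le_self: "sublinear q \<Longrightarrow> tilt q y x \<le> q x"
  using tilt_le[of q 0 y x] by simp

text \<open>Shifts \<open>t\<close> for \<open>x\<close> and \<open>s\<close> for \<open>x'\<close>
  combine to the admissible shift \<open>t + s\<close> for \<open>x + x'\<close>. Homogeneity comes
  from rescaling the shift by \<open>r\<close>; the reverse inequality is the same one applied with
  \<open>1 / r\<close>.\<close>

lemma sublinear_tilt:
  assumes q: "sublinear q"
  shows "sublinear (tilt q y)"
  unfolding sublinear_def
proof (intro conjI allI impI)
  fix x x'
  have "tilt q y (x + x') - tilt q y x' \<le> tilt q y x"
  proof (rule tilt_ge)
    fix t :: real assume t: "t \<ge> 0"
    have "tilt q y (x + x') - (q (x + t *\<^sub>R y) - t * q y) \<le> tilt q y x'"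
    proof (rule tilt_ge)
      fix s :: real assume s: "s \<ge> 0"
      have "tilt q y (x + x') \<le> q ((x + x') + (t + s) *\<^sub>R y) - (t + s) * q y"
        using s t by (intro tilt_le[OF q]) simp
      also have "(x + x') + (t + s) *\<^sub>R y = (x + t *\<^sub>R y) + (x' + s *\<^sub>R y)"
        by (simp add: algebra_simps)
      finally show "tilt q y (x + x') - (q (x + t *\<^sub>R y) - t * q y) \<le> q (x' + s *\<^sub>R y) - s * q y"
        using sublinear_add[OF q, of "x + t *\<^sub>R y" "x' + s *\<^sub>R y"] by (simp add: algebra_simps)
    qed
    then show "tilt q y (x + x') - tilt q y x' \<le> q (x + t *\<^sub>R y) - t * q y" by linarith
  qed
  then show "tilt q y (x + x') \<le> tilt q y x + tilt q y x'" by linarith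
next
  fix r :: real and x assume r: "r \<ge> 0"
  have le: "tilt q y (r *\<^sub>R x) \<le> r * tilt q y x" if "r > 0" for r x
  proof -
    have "tilt q y (r *\<^sub>R x) / r \<le> tilt q y x"
    proof (rule tilt_ge)
      fix t :: real assume t: "t \<ge> 0"
      have "tilt q y (r *\<^sub>R x) \<le> q (r *\<^sub>R x + (r * t) *\<^sub>R y) - r * t * q y"
        using t that by (intro tilt_le[OF q]) simp
      also have "r *\<^sub>R x + (r * t) *\<^sub>R y = r *\<^sub>R (x + t *\<^sub>R y)" by (simp add: algebra_simps)
      finally show "tilt q y (r *\<^sub>R x) / r \<le> q (x + t *\<^sub>R y) - t * q y"
        using that sublinear_scaleR[OF q, of r "x + t *\<^sub>R y"] by (simp add: field_simps)
    qed
    then show ?thesis using that by (simp add: field_simps)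
  qed
  show "tilt q y (r *\<^sub>R x) = r * tilt q y x"
  proof (cases "r = 0")
    case True
    have "0 \<le> tilt q y 0"
      by (rule tilt_ge) (simp add: sublinear_scaleR[OF q])
    moreover have "tilt q y 0 \<le> 0" using tilt_le_self[OF q, of y 0] sublinear_zero[OF q] by simp
    ultimately show ?thesis using True by simp
  next
    case False
    then have "r > 0" using r by simp
    then show ?thesis using le[of r x] le[of "1 / r" "r *\<^sub>R x"] by (simp add: field_simps)
  qed
qed

lemma linear_of_minimal_sublinear:
  assumes q: "sublinear q" and min: "\<And>q'. sublinear q' \<Longrightarrow> (\<And>x. q' x \<le> q x) \<Longrightarrow> q' = q"
  shows "linear q"
proof -
  have add: "q (x + y) = q x + q y" for x y
  proof -
    have "tilt q y = q" using min sublinear_tilt[OF q] tilt_le_self[OF q] by blast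
    then have "q x \<le> q (x + 1 *\<^sub>R y) - 1 * q y" using tilt_le[OF q, of 1 y x] by simp
    then show ?thesis using sublinear_add[OF q, of x y] by simp
  qed
  have neg: "q (- x) = - q x" for x
    using add[of x "- x"] sublinear_zero[OF q] by simp
  have "q (r *\<^sub>R x) = r * q x" for r x
    using sublinear_scaleR[OF q, of r x] sublinear_scaleR[OF q, of "- r" x] neg[of "r *\<^sub>R x"]
    by (cases "r \<ge> 0") auto
  then show ?thesis using add by (intro linearI) auto
qed

text \<open>Zorn's lemma, with the order reversed, yields a minimal sublinear functional below
  \<open>p\<close>, and minimal ones are linear. The lower bound of a chain is its pointwise
  infimum, so no extension from subspaces is involved.\<close>

lemma exists_linear_le_sublinear:
  fixes p :: "'v::real_vector \<Rightarrow> real"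
  assumes p: "sublinear p"
  obtains f where "linear f" "\<And>x. f x \<le> p x"
proof -
  define A where "A = {q. sublinear q \<and> q \<le> p}"
  have "\<exists>m\<in>A. \<forall>a\<in>A. a \<le> m \<longrightarrow> a = m"
  proof (rule predicate_Zorn[of A "\<lambda>a b. b \<le> a"])
    show "partial_order_on A (relation_of (\<lambda>a b. b \<le> a) A)"
      by (rule partial_order_on_relation_ofI) auto
  next
    fix C assume C: "C \<in> Chains (relation_of (\<lambda>a b. b \<le> a) A)"
    have CA: "C \<subseteq> A" using C by (auto simp: Chains_def relation_of_def)
    have chain: "a \<le> b \<or> b \<le> a" if "a \<in> C" "b \<in> C" for a b
      using C that by (auto simp: Chains_def relation_of_def)
    show "\<exists>u\<in>A. \<forall>a\<in>C. u \<le> a"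
    proof (cases "C = {}")
      case True
      then show ?thesis using p by (auto simp: A_def)
    next
      case False
      define u where "u x = (INF q\<in>C. q x)" for x
      have q: "sublinear q" "q \<le> p" if "q \<in> C" for q using that CA by (auto simp: A_def)
      \<comment> \<open>The infimum is finite because
        \<open>- p (- x) \<le> - q (- x) \<le> q x\<close>.\<close>
      have bdd: "bdd_below ((\<lambda>q. q x) ` C)" for x
      proof (rule bdd_belowI2)
        fix q assume "q \<in> C"
        then show "- p (- x) \<le> q x"
          using q[of q] sublinear_minus[of q x] by (auto simp: le_fun_def) (smt (verit))
      qed
      have u_le: "u x \<le> q x" if "q \<in> C" for q x
        unfolding u_def using that by (intro cINF_lower[OF bdd]) auto
      have u_ge: "c \<le> u x" if "\<And>q. q \<in> C \<Longrightarrow> c \<le> q x" for c x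
        unfolding u_def using that False by (intro cINF_greatest) auto
      have "sublinear u"
        unfolding sublinear_def
      proof (intro conjI allI impI)
        fix x y
        have "u (x + y) - u y \<le> u x"
        proof (rule u_ge)
          fix q1 assume q1: "q1 \<in> C"
          have "u (x + y) - q1 x \<le> u y"
          proof (rule u_ge)
            fix q2 assume q2: "q2 \<in> C"
            \<comment> \<open>The smaller of \<open>q1\<close> and \<open>q2\<close> serves both
              arguments, so subadditivity of a single functional suffices.\<close>
            obtain q3 where q3: "q3 \<in> C" "q3 \<le> q1" "q3 \<le> q2" using chain[OF q1 q2] q1 q2 by blast
            then show "u (x + y) - q1 x \<le> q2 y"
              using u_le[OF q3(1), of "x + y"] sublinear_add[OF q(1)[OF q3(1)], of x y]
              by (smt (verit) le_funD)
          qed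
          then show "u (x + y) - u y \<le> q1 x" by linarith
        qed
        then show "u (x + y) \<le> u x + u y" by linarith
      next
        fix r :: real and x assume r: "r \<ge> 0"
        have le: "u (r *\<^sub>R x) \<le> r * u x" if "r > 0" for r x
        proof -
          have "u (r *\<^sub>R x) / r \<le> u x"
          proof (rule u_ge)
            fix q' assume "q' \<in> C"
            then show "u (r *\<^sub>R x) / r \<le> q' x"
              using u_le[of q' "r *\<^sub>R x"] sublinear_scaleR[OF q(1), of q' r x] that
              by (simp add: field_simps)
          qed
          then show ?thesis using that by (simp add: field_simps)
        qed
        show "u (r *\<^sub>R x) = r * u x"
        proof (cases "r = 0")
          case True
          have "u 0 = 0" unfolding u_def using False q(1) by (simp add: sublinear_zero)
          then show ?thesis using True by simp
        next
          case False
          then have "r > 0" using r by simp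
          then show ?thesis using le[of r x] le[of "1 / r" "r *\<^sub>R x"] by (simp add: field_simps)
        qed
      qed
      moreover have "u \<le> p" using False q(2) u_le by (meson all_not_in_conv le_fun_def order_trans)
      ultimately show ?thesis using u_le by (auto simp: A_def le_fun_def)
    qed
  qed
  then obtain f where f: "f \<in> A" "\<And>a. a \<in> A \<Longrightarrow> a \<le> f \<Longrightarrow> a = f" by blast
  have "linear f"
  proof (rule linear_of_minimal_sublinear)
    show "sublinear f" using f by (simp add: A_def)
    fix q' assume "sublinear q'" "\<And>x. q' x \<le> f x"
    moreover from this have "q' \<in> A" using f(1) by (auto simp: A_def le_fun_def intro: order_trans)
    ultimately show "q' = f" by (intro f(2)) (auto simp: le_fun_def)
  qed
  then show ?thesis using that f by (auto simp: A_def le_fun_def)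
qed

text \<open>Dominating by \<open>tilt norm d\<close> instead of the norm builds in the norming
  property: at \<open>- d\<close> the choice \<open>t = 1\<close> gives the value
  \<open>- norm d\<close>, hence \<open>f (- d) \<le> - norm d\<close>.\<close>

lemma exists_norming_functional:
  fixes d :: "'v::real_normed_vector"
  obtains f :: "'v \<Rightarrow> real" where "linear f" "\<And>x. \<bar>f x\<bar> \<le> norm x" "f d = norm d"
proof -
  have norm: "sublinear (norm :: 'v \<Rightarrow> real)"
    by (auto simp: sublinear_def norm_triangle_ineq)
  obtain f where f: "linear f" "\<And>x. f x \<le> tilt norm d x"
    using exists_linear_le_sublinear[OF sublinear_tilt[OF norm]] by blast
  have le: "f x \<le> norm x" for x using f(2) tilt_le_self[OF norm] by (meson order_trans)
  have abs: "\<bar>f x\<bar> \<le> norm x" for x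
    using le[of x] le[of "- x"] linear_neg[OF f(1), of x] by simp
  have "f (- d) \<le> - norm d"
    using f(2)[of "- d"] tilt_le[OF norm, of 1 d "- d"] by simp
  then have "f d = norm d" using le[of d] linear_neg[OF f(1), of d] by simp
  with f(1) abs that show ?thesis by blast
qed

text \<open>Take norming functionals at the points of a countable dense set. If all vanish at
  \<open>x\<close> and \<open>d\<close> is a dense point within \<open>norm x / 2\<close> of
  \<open>x\<close>, then \<open>norm d = g d (d - x) \<le> norm (d - x)\<close>, so \<open>d\<close>
  is too small to be that close to \<open>x\<close>.\<close>

lemma exists_separating_functionals:
  obtains f :: "nat \<Rightarrow> 'v::{real_normed_vector, second_countable_topology} \<Rightarrow> real"
  where "\<And>n. bounded_linear (f n)" "\<And>x. (\<And>n. f n x = 0) \<Longrightarrow> x = 0"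
proof -
  obtain D :: "'v set" where D: "countable D" "\<And>X. open X \<Longrightarrow> X \<noteq> {} \<Longrightarrow> \<exists>d\<in>D. d \<in> X"
    using countable_dense_setE by metis
  have D_ne: "D \<noteq> {}" using D(2)[of UNIV] by auto
  have "\<exists>g :: 'v \<Rightarrow> real. linear g \<and> (\<forall>x. \<bar>g x\<bar> \<le> norm x) \<and> g d = norm d" for d
    using exists_norming_functional[of d] by metis
  then obtain g :: "'v \<Rightarrow> 'v \<Rightarrow> real"
    where g: "\<And>d. linear (g d)" "\<And>d x. \<bar>g d x\<bar> \<le> norm x" "\<And>d. g d d = norm d" by metis
  show ?thesis
  proof (rule that[of "\<lambda>n. g (from_nat_into D n)"])
    show "bounded_linear (g (from_nat_into D n))" for n
      using g(1,2) by (intro bounded_linear.intro bounded_linear_axioms.intro exI[of _ 1])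
        (auto simp: linear_def)
    fix x assume x: "\<And>n. g (from_nat_into D n) x = 0"
    show "x = 0"
    proof (rule ccontr)
      assume "x \<noteq> 0"
      then obtain d where d: "d \<in> D" "d \<in> ball x (norm x / 2)"
        using D(2)[of "ball x (norm x / 2)"] by auto
      have "g d x = 0" using x[of "to_nat_on D d"] d D(1) by simp
      then have "norm d \<le> norm (d - x)"
        using g(2)[of d "d - x"] g(3)[of d] linear_diff[OF g(1), of d d x] by simp
      moreover have "norm (d - x) < norm x / 2" using d(2) by (simp add: dist_norm norm_minus_commute)
      moreover have "norm x \<le> norm d + norm (d - x)" by (metis norm_triangle_sub norm_minus_commute)
      ultimately show False by linarith
    qed
  qed
qed

text \<open>If every member of a countable separating family were a.e. constant, all of them would
  be constant on one common set of full measure. Separation then reduces that set to a single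
  point.\<close>

lemma nondegenerate_functional:
  fixes \<nu> :: "'b::{real_normed_vector, second_countable_topology} measure"
  assumes \<nu>: "borel_prob \<nu>" and nd: "nondegenerate \<nu>"
  obtains f :: "'b \<Rightarrow> real" where "bounded_linear f" "\<And>c. \<not> (AE x in \<nu>. f x = c)"
proof -
  interpret prob_space \<nu> using \<nu> by (simp add: borel_prob_def)
  have sets: "sets \<nu> = sets borel" using \<nu> by (simp add: borel_prob_def)
  obtain f :: "nat \<Rightarrow> 'b \<Rightarrow> real"
    where f: "\<And>n. bounded_linear (f n)" "\<And>x. (\<And>n. f n x = 0) \<Longrightarrow> x = 0"
    using exists_separating_functionals by metis
  have "\<exists>n. \<forall>c. \<not> (AE x in \<nu>. f n x = c)"
  proof (rule ccontr)
    assume "\<not> ?thesis"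
    then obtain c where "\<And>n. AE x in \<nu>. f n x = c n" by metis
    then have ae: "AE x in \<nu>. \<forall>n. f n x = c n" by (simp add: AE_all_countable)
    then obtain x0 where x0: "\<And>n. f n x0 = c n"
      using eventually_happens'[OF ae_filter_bot ae] by blast
    have "AE x in \<nu>. x \<in> {x0}"
      using ae
    proof eventually_elim
      case (elim x)
      then have "x - x0 = 0" using x0 by (intro f(2)) (simp add: bounded_linear.linear[OF f(1)] linear_diff)
      then show ?case by simp
    qed
    then have "prob {x0} = 1" by (subst prob_eq_1) (auto simp: sets)
    then show False using nd by (auto simp: nondegenerate_def)
  qed
  then show ?thesis using that f(1) by blast
qed

subsection \<open>Characteristic functions and symmetrised second moments\<close>

lemma one_minus_cos_le: "1 - cos x \<le> x\<^sup>2 / 2" for x :: real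
proof -
  have "1 - cos x = 2 * (sin (x / 2))\<^sup>2" using cos_double_sin[of "x / 2"] by simp
  also have "\<dots> \<le> 2 * (x / 2)\<^sup>2"
    using abs_sin_x_le_abs_x[of "x / 2"] unfolding abs_le_square_iff by simp
  finally show ?thesis by (simp add: power2_eq_square)
qed

text \<open>By the half-angle formula the quotient is \<open>z\<^sup>2 / 2\<close> times the square
  of \<open>sin u / u\<close> at \<open>u = s n * z / 2\<close>.\<close>

lemma one_minus_cos_div_tendsto:
  fixes z :: real
  assumes s: "s \<longlonglongrightarrow> 0" "\<And>n. s n \<noteq> 0"
  shows "(\<lambda>n. (1 - cos (s n * z)) / (s n)\<^sup>2) \<longlonglongrightarrow> z\<^sup>2 / 2"
proof (cases "z = 0")
  case False
  have "((\<lambda>u::real. sin u / u) \<longlongrightarrow> 1) (at 0)"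
    using DERIV_sin[of 0] by (simp add: DERIV_def)
  moreover have "filterlim (\<lambda>n. s n * z / 2) (at 0) sequentially"
    using s False by (auto simp: filterlim_at intro!: tendsto_eq_intros)
  ultimately have "(\<lambda>n. sin (s n * z / 2) / (s n * z / 2)) \<longlonglongrightarrow> 1"
    by (rule filterlim_compose)
  then have "(\<lambda>n. (sin (s n * z / 2) / (s n * z / 2))\<^sup>2 * (z\<^sup>2 / 2)) \<longlonglongrightarrow> 1\<^sup>2 * (z\<^sup>2 / 2)"
    by (intro tendsto_intros)
  moreover have "(sin (s n * z / 2) / (s n * z / 2))\<^sup>2 * (z\<^sup>2 / 2) = (1 - cos (s n * z)) / (s n)\<^sup>2" for n
    using s(2)[of n] False cos_double_sin[of "s n * z / 2"] by (simp add: field_simps)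
  ultimately show ?thesis by (simp only: one_power2 mult_1)
qed simp

context real_distribution
begin

lemma integrable_cos_diff: "integrable (M \<Otimes>\<^sub>M M) (\<lambda>z. cos (t * (fst z - snd z)))"
proof -
  interpret pair_prob_space M M ..
  show ?thesis by (rule P.integrable_const_bound[of _ 1]) auto
qed

lemma integrable_one_minus_cos_diff: "integrable (M \<Otimes>\<^sub>M M) (\<lambda>z. 1 - cos (t * (fst z - snd z)))"
proof -
  interpret pair_prob_space M M ..
  show ?thesis using integrable_cos_diff by simp
qed

text \<open>The squared modulus of a characteristic function is the characteristic function of the
  difference of two independent copies, and that one is real by symmetry.\<close>

lemma one_minus_norm_char_sq:
  "1 - (cmod (char M t))\<^sup>2 = (\<integral>z. 1 - cos (t * (fst z - snd z)) \<partial>(M \<Otimes>\<^sub>M M))"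
proof -
  have bd: "integrable M g" if "g \<in> borel_measurable borel" "\<And>x. \<bar>g x\<bar> \<le> 1" for g :: "real \<Rightarrow> real"
    by (rule integrable_const_bound[of _ 1]) (use that in auto)
  have [simp]: "integrable M (\<lambda>x. cos (t * x))" "integrable M (\<lambda>x. sin (t * x))"
    by (auto intro!: bd)
  have "complex_integrable M (\<lambda>x. iexp (t * x))" by (rule integrable_iexp) auto
  then have Re: "Re (char M t) = (\<integral>x. cos (t * x) \<partial>M)" and Im: "Im (char M t) = (\<integral>x. sin (t * x) \<partial>M)"
    by (simp_all add: char_def flip: integral_Re integral_Im) (simp_all add: Re_exp Im_exp)
  interpret pair_prob_space M M ..
  have int: "integrable (M \<Otimes>\<^sub>M M) (\<lambda>z. cos (t * (fst z - snd z)))"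
    by (rule integrable_cos_diff)
  have "(\<integral>z. cos (t * (fst z - snd z)) \<partial>(M \<Otimes>\<^sub>M M)) = (\<integral>x. (\<integral>y. cos (t * (x - y)) \<partial>M) \<partial>M)"
    using integral_fst'[OF int] by simp
  also have "\<dots> = (\<integral>x. cos (t * x) * Re (char M t) + sin (t * x) * Im (char M t) \<partial>M)"
    by (simp add: Re Im right_diff_distrib cos_diff)
  also have "\<dots> = (cmod (char M t))\<^sup>2"
    unfolding cmod_power2 by (simp add: Re Im power2_eq_square)
  finally show ?thesis using int by (simp add: P.prob_space)
qed

text \<open>The truncation at 2 makes the bound the integral of a bounded continuous function, to
  which weak convergence applies.\<close>

lemma one_minus_norm_char_le: "1 - cmod (char M t) \<le> (\<integral>x. min 2 \<bar>t * x\<bar> \<partial>M)"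
proof -
  have int: "complex_integrable M (\<lambda>x. iexp (t * x))" by (rule integrable_iexp) auto
  have "cmod (char M t - 1) = cmod (\<integral>x. iexp (t * x) - 1 \<partial>M)"
    using int by (simp add: char_def prob_space del: space_eq_univ)
  also have "\<dots> \<le> (\<integral>x. cmod (iexp (t * x) - 1) \<partial>M)" by (rule integral_norm_bound)
  also have "\<dots> \<le> (\<integral>x. min 2 \<bar>t * x\<bar> \<partial>M)"
  proof (rule integral_mono)
    show "cmod (iexp (t * x) - 1) \<le> min 2 \<bar>t * x\<bar>" for x
      using iexp_approx1[of "t * x" 0] iexp_approx2[of "t * x" 0] by simp
    show "integrable M (\<lambda>x. min 2 \<bar>t * x\<bar>)"
      by (intro integrable_const_bound[of _ 2]) auto
  qed (use int in auto)
  finally show ?thesis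
    using norm_triangle_ineq2[of 1 "char M t"] by (simp add: norm_minus_commute)
qed

text \<open>Fatou's lemma: a quadratic bound along a single null sequence already bounds the second
  moment of the difference. The integral is extended-valued because integrability is what this is
  meant to establish.\<close>

lemma nn_integral_sq_diff_le:
  assumes s: "s \<longlonglongrightarrow> 0" "\<And>n. s n \<noteq> 0"
    and le: "\<forall>\<^sub>F n in sequentially. 1 - (cmod (char M (s n)))\<^sup>2 \<le> C * (s n)\<^sup>2"
  shows "(\<integral>\<^sup>+z. ennreal ((fst z - snd z)\<^sup>2 / 2) \<partial>(M \<Otimes>\<^sub>M M)) \<le> ennreal C"
proof -
  interpret pair_prob_space M M ..
  define u where "u n z = ennreal ((1 - cos (s n * (fst z - snd z))) / (s n)\<^sup>2)" for n and z :: "real \<times> real"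
  have [measurable]: "u n \<in> borel_measurable (M \<Otimes>\<^sub>M M)" for n unfolding u_def by measurable
  have int: "integrable (M \<Otimes>\<^sub>M M) (\<lambda>z. (1 - cos (s n * (fst z - snd z))) / (s n)\<^sup>2)" for n
    by (intro integrable_divide integrable_one_minus_cos_diff)
  have "(\<lambda>n. u n z) \<longlonglongrightarrow> ennreal ((fst z - snd z)\<^sup>2 / 2)" for z
    unfolding u_def by (intro tendsto_ennrealI one_minus_cos_div_tendsto s)
  then have "(\<integral>\<^sup>+z. ennreal ((fst z - snd z)\<^sup>2 / 2) \<partial>(M \<Otimes>\<^sub>M M)) = (\<integral>\<^sup>+z. liminf (\<lambda>n. u n z) \<partial>(M \<Otimes>\<^sub>M M))"
    by (metis lim_imp_Liminf trivial_limit_sequentially)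
  also have "\<dots> \<le> liminf (\<lambda>n. \<integral>\<^sup>+z. u n z \<partial>(M \<Otimes>\<^sub>M M))"
    by (rule nn_integral_liminf) simp
  also have "\<dots> \<le> liminf (\<lambda>n. ennreal C)"
  proof (rule Liminf_mono)
    show "\<forall>\<^sub>F n in sequentially. (\<integral>\<^sup>+z. u n z \<partial>(M \<Otimes>\<^sub>M M)) \<le> ennreal C"
      using le
    proof eventually_elim
      case (elim n)
      have "(\<integral>\<^sup>+z. u n z \<partial>(M \<Otimes>\<^sub>M M)) = ennreal ((1 - (cmod (char M (s n)))\<^sup>2) / (s n)\<^sup>2)"
        unfolding u_def
        by (subst nn_integral_eq_integral[OF int]) (auto simp: one_minus_norm_char_sq)
      also have "\<dots> \<le> ennreal C"
        using elim s(2)[of n] by (intro ennreal_leI) (simp add: divide_le_eq)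
      finally show ?case .
    qed
  qed
  also have "\<dots> = ennreal C" by (simp add: Liminf_const)
  finally show ?thesis .
qed

text \<open>The case \<open>C = 0\<close> of the Fatou bound makes two independent copies a.e.
  equal; by Fubini almost every value of the first is then an a.e. constant for the second.\<close>

lemma degenerate_if_norm_char_eq_1:
  assumes s: "s \<longlonglongrightarrow> 0" "\<And>n. s n \<noteq> 0" and eq: "\<And>n. cmod (char M (s n)) = 1"
  shows "\<exists>c. AE x in M. x = c"
proof -
  interpret pair_prob_space M M ..
  have "(\<integral>\<^sup>+z. ennreal ((fst z - snd z)\<^sup>2 / 2) \<partial>(M \<Otimes>\<^sub>M M)) \<le> ennreal 0"
    by (rule nn_integral_sq_diff_le[OF s]) (simp add: eq)
  then have "AE z in M \<Otimes>\<^sub>M M. ennreal ((fst z - snd z)\<^sup>2 / 2) = 0"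
    by (subst nn_integral_0_iff_AE[symmetric]) auto
  then have "AE z in M \<Otimes>\<^sub>M M. fst z = snd z" by (simp add: ennreal_eq_0_iff)
  then have "AE x in M. AE y in M. x = y" using AE_pair by fastforce
  then show ?thesis using eventually_happens'[OF ae_filter_bot] by (metis (mono_tags, lifting) AE_mp AE_I2)
qed

text \<open>The variance of \<open>M\<close> when the integrand is integrable. Otherwise the Bochner
  integral defaults to 0, hence the integrability hypotheses below.\<close>

definition sq_diff :: real where
  "sq_diff = (\<integral>z. (fst z - snd z)\<^sup>2 / 2 \<partial>(M \<Otimes>\<^sub>M M))"

lemma one_minus_norm_char_sq_le:
  assumes "integrable (M \<Otimes>\<^sub>M M) (\<lambda>z. (fst z - snd z)\<^sup>2 / 2)"
  shows "1 - (cmod (char M t))\<^sup>2 \<le> t\<^sup>2 * sq_diff"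
proof -
  interpret pair_prob_space M M ..
  have "(\<integral>z. 1 - cos (t * (fst z - snd z)) \<partial>(M \<Otimes>\<^sub>M M)) \<le> (\<integral>z. t\<^sup>2 * ((fst z - snd z)\<^sup>2 / 2) \<partial>(M \<Otimes>\<^sub>M M))"
  proof (rule integral_mono)
    show "integrable (M \<Otimes>\<^sub>M M) (\<lambda>z. 1 - cos (t * (fst z - snd z)))"
      by (rule integrable_one_minus_cos_diff)
    show "integrable (M \<Otimes>\<^sub>M M) (\<lambda>z. t\<^sup>2 * ((fst z - snd z)\<^sup>2 / 2))"
      using assms by (intro integrable_mult_right) auto
    show "1 - cos (t * (fst z - snd z)) \<le> t\<^sup>2 * ((fst z - snd z)\<^sup>2 / 2)" for z
      using one_minus_cos_le[of "t * (fst z - snd z)"] by (simp add: power_mult_distrib)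
  qed
  then show ?thesis unfolding one_minus_norm_char_sq sq_diff_def by simp
qed

text \<open>Once the second moment is finite, \<open>(fst z - snd z)\<^sup>2 / 2\<close> dominates
  the difference quotients, which upgrades the Fatou bound along one sequence to a limit along every
  null sequence.\<close>

lemma one_minus_norm_char_sq_tendsto:
  assumes int: "integrable (M \<Otimes>\<^sub>M M) (\<lambda>z. (fst z - snd z)\<^sup>2 / 2)"
    and s: "s \<longlonglongrightarrow> 0" "\<And>n. s n \<noteq> 0"
  shows "(\<lambda>n. (1 - (cmod (char M (s n)))\<^sup>2) / (s n)\<^sup>2) \<longlonglongrightarrow> sq_diff"
proof -
  interpret pair_prob_space M M ..
  have "(\<lambda>n. \<integral>z. (1 - cos (s n * (fst z - snd z))) / (s n)\<^sup>2 \<partial>(M \<Otimes>\<^sub>M M)) \<longlonglongrightarrow> sq_diff"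
    unfolding sq_diff_def
  proof (rule integral_dominated_convergence[OF _ _ int])
    show "AE z in M \<Otimes>\<^sub>M M. (\<lambda>n. (1 - cos (s n * (fst z - snd z))) / (s n)\<^sup>2) \<longlonglongrightarrow> (fst z - snd z)\<^sup>2 / 2"
      by (intro AE_I2 one_minus_cos_div_tendsto s)
    have "(1 - cos (s n * y)) / (s n)\<^sup>2 \<le> y\<^sup>2 / 2" for n y
      using one_minus_cos_le[of "s n * y"] s(2)[of n] by (simp add: divide_le_eq power_mult_distrib mult.commute)
    then show "AE z in M \<Otimes>\<^sub>M M. norm ((1 - cos (s n * (fst z - snd z))) / (s n)\<^sup>2) \<le> (fst z - snd z)\<^sup>2 / 2" for n
      by (intro AE_I2) simp
  qed auto
  then show ?thesis by (simp add: one_minus_norm_char_sq)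
qed

end

subsection \<open>Convergence of the norming sequence\<close>

text \<open>With \<open>g = |char P|\<^sup>2\<close>, taking logarithms in
  \<open>g (t0 / a n) ^ n \<longlonglongrightarrow> h\<close> gives
  \<open>n * (1 - g (t0 / a n)) \<longlonglongrightarrow> - ln h\<close>. Dividing by
  \<open>(1 - g u) / u\<^sup>2 \<longlonglongrightarrow> \<sigma>\<close> at
  \<open>u = t0 / a n\<close> leaves \<open>n * (t0 / a n)\<^sup>2\<close>. The bounds by
  \<open>1 / 2\<close> stand in for tightness.\<close>

lemma norming_sequence_convergent:
  assumes P: "real_distribution P" and Q: "real_distribution Q"
    and m: "strict_mono m" "\<And>k. m k \<ge> 1"
    and R: "R > 0" "\<forall>\<^sub>F k in sequentially. \<forall>t. \<bar>t\<bar> \<le> R \<longrightarrow> 1 / 2 \<le> cmod (char P (t / sqrt (real (m k))) ^ m k)"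
    and a: "\<And>n. n \<ge> 1 \<Longrightarrow> a n > 0"
    and T: "T > 0" "\<forall>\<^sub>F n in sequentially. \<forall>t. \<bar>t\<bar> \<le> T \<longrightarrow> 1 / 2 \<le> cmod (char P (t / a n) ^ n)"
    and lim: "\<And>t. (\<lambda>n. char P (t / a n) ^ n) \<longlonglongrightarrow> char Q t"
    and nondeg: "\<And>c. \<not> (AE x in Q. x = c)"
  shows "\<exists>c. (\<lambda>n. a n / sqrt (real n)) \<longlonglongrightarrow> c"
proof -
  interpret P: real_distribution P by fact
  interpret Q: real_distribution Q by fact
  define g where "g t = (cmod (char P t))\<^sup>2" for t
  have g_le: "g t \<le> 1" for t
    using P.cmod_char_le_1[of t] by (simp add: g_def power_le_one)
  have norm_pow: "g t ^ n = (cmod (char P t ^ n))\<^sup>2" for t n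
    by (simp add: g_def norm_power flip: power_mult) (simp add: mult.commute)

  define s where "s k = R / sqrt (real (m k))" for k
  have m_top: "filterlim (\<lambda>k. real (m k)) at_top sequentially"
    using filterlim_compose[OF filterlim_real_sequentially filterlim_subseq[OF m(1)]] .
  have s0: "s \<longlonglongrightarrow> 0"
    unfolding s_def
    by (intro tendsto_divide_0[OF tendsto_const] filterlim_at_top_imp_at_infinity
        filterlim_compose[OF sqrt_at_top m_top])
  have m_pos: "real (m k) > 0" for k using m(2)[of k] by simp
  have s_pos: "s k \<noteq> 0" for k using R(1) m_pos[of k] by (simp add: s_def)
  \<comment> \<open>Squaring the bound \<open>1 / 2\<close> gives
    \<open>g (s k) ^ m k \<ge> 1 / 4\<close>, and \<open>ln x \<le> x - 1\<close> turns this into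
    \<open>m k * (1 - g (s k)) \<le> ln 4\<close>. The factor \<open>1 / R\<^sup>2\<close> comes
    from \<open>1 / m k = (s k / R)\<^sup>2\<close>.\<close>
  have "\<forall>\<^sub>F k in sequentially. 1 - (cmod (char P (s k)))\<^sup>2 \<le> ln 4 / R\<^sup>2 * (s k)\<^sup>2"
    using R(2)
  proof eventually_elim
    case (elim k)
    have "1 / 2 \<le> cmod (char P (s k) ^ m k)" using elim R(1) by (simp add: s_def)
    then have "(1 / 2)\<^sup>2 \<le> g (s k) ^ m k" unfolding norm_pow by (intro power_mono) auto
    then have ge: "1 / 4 \<le> g (s k) ^ m k" by (simp add: power2_eq_square)
    have "0 \<le> g (s k)" by (simp add: g_def)
    moreover have "g (s k) \<noteq> 0" using ge m(2)[of k] by (auto simp: power_0_left)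
    ultimately have pos: "0 < g (s k)" by simp
    have "- ln 4 \<le> ln (g (s k) ^ m k)"
      using ge pos by (subst ln_inverse[symmetric]) (auto simp: ln_le_cancel_iff)
    also have "\<dots> = real (m k) * ln (g (s k))" using pos by (simp add: ln_realpow)
    also have "\<dots> \<le> real (m k) * (g (s k) - 1)"
      using pos by (intro mult_left_mono ln_le_minus_one) auto
    finally have "1 - g (s k) \<le> ln 4 / real (m k)"
      using m_pos[of k] by (simp add: field_simps)
    then show ?case using R(1) m_pos[of k] by (simp add: g_def s_def power_divide)
  qed
  from P.nn_integral_sq_diff_le[OF s0 s_pos this]
  have int: "integrable (P \<Otimes>\<^sub>M P) (\<lambda>z. (fst z - snd z)\<^sup>2 / 2)"
    by (intro integrableI_nonneg) (auto simp: less_top[symmetric] top_unique)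
  define \<sigma> where "\<sigma> = P.sq_diff"

  \<comment> \<open>Non-degeneracy of \<open>Q\<close> provides \<open>h < 1\<close>; keeping
    \<open>t0\<close> within \<open>T\<close> provides \<open>h > 0\<close> through the lower bound
    \<open>1 / 2\<close>.\<close>
  have "\<exists>t0. 0 < t0 \<and> t0 \<le> T \<and> cmod (char Q t0) \<noteq> 1"
  proof (rule ccontr)
    assume "\<not> ?thesis"
    then have *: "cmod (char Q t) = 1" if "0 < t" "t \<le> T" for t using that by blast
    have "(\<lambda>n. T * inverse (real (Suc n))) \<longlonglongrightarrow> T * 0"
      by (intro tendsto_intros LIMSEQ_inverse_real_of_nat)
    then have "\<exists>c. AE x in Q. x = c"
      using T(1) by (intro Q.degenerate_if_norm_char_eq_1[of "\<lambda>n. T * inverse (real (Suc n))"] *)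
        (auto simp: field_simps)
    then show False using nondeg by blast
  qed
  then obtain t0 where t0: "0 < t0" "t0 \<le> T" "cmod (char Q t0) \<noteq> 1" by blast
  define h where "h = (cmod (char Q t0))\<^sup>2"
  have glim: "(\<lambda>n. g (t0 / a n) ^ n) \<longlonglongrightarrow> h"
    unfolding norm_pow h_def by (intro tendsto_intros lim)
  have "1 / 2 \<le> cmod (char Q t0)"
    by (rule tendsto_lowerbound[OF tendsto_norm[OF lim]])
       (use T(2) t0 in \<open>auto elim!: eventually_mono\<close>)
  then have h: "0 < h" "h < 1"
    using t0(3) Q.cmod_char_le_1[of t0] by (auto simp: h_def power_less_one_iff)

  \<comment> \<open>Otherwise \<open>|char P|\<close> would be identically 1, which forces
    \<open>h = 1\<close>.\<close>
  have "\<sigma> > 0"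
  proof (rule ccontr)
    assume "\<not> \<sigma> > 0"
    then have "g t = 1" for t
      using P.one_minus_norm_char_sq_le[OF int, of t] g_le[of t] mult_nonneg_nonpos[of "t\<^sup>2" \<sigma>]
      by (auto simp: g_def \<sigma>_def)
    then have "h = 1" using glim by (simp add: LIMSEQ_const_iff)
    then show False using h by simp
  qed

  have g_quot: "(\<lambda>n. (1 - g (u n)) / (u n)\<^sup>2) \<longlonglongrightarrow> \<sigma>" if "u \<longlonglongrightarrow> 0" "\<And>n. u n \<noteq> 0" for u
    unfolding g_def \<sigma>_def by (rule P.one_minus_norm_char_sq_tendsto[OF int that])

  \<comment> \<open>Since \<open>\<sigma> > 0\<close>, there are arbitrarily small
    \<open>v > 0\<close> with \<open>|char P v| < 1\<close>. If \<open>v * a n \<le> T\<close>, the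
    lower bound at \<open>t = v * a n\<close> reads \<open>|char P v| ^ n \<ge> 1 / 2\<close>, which
    fails for large \<open>n\<close>.\<close>
  have inv_a: "(\<lambda>n. T / a n) \<longlonglongrightarrow> 0"
  proof (rule LIMSEQ_I)
    fix e :: real assume e: "e > 0"
    have "(\<lambda>n. e * inverse (real (Suc n))) \<longlonglongrightarrow> e * 0"
      by (intro tendsto_intros LIMSEQ_inverse_real_of_nat)
    then have "(\<lambda>n. (1 - g (e * inverse (real (Suc n)))) / (e * inverse (real (Suc n)))\<^sup>2) \<longlonglongrightarrow> \<sigma>"
      using e by (intro g_quot) auto
    from order_tendstoD(1)[OF this \<open>\<sigma> > 0\<close>]
    obtain n0 where n0: "0 < (1 - g (e * inverse (real (Suc n0)))) / (e * inverse (real (Suc n0)))\<^sup>2"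
      by (auto simp: eventually_sequentially)
    define v where "v = e * inverse (real (Suc n0))"
    have v: "0 < v" "v \<le> e" using e by (auto simp: v_def field_simps)
    have "g v < 1" using n0 v(1) unfolding v_def[symmetric] by (auto simp: zero_less_divide_iff)
    then have "cmod (char P v) < 1" using P.cmod_char_le_1[of v] by (auto simp: g_def less_le)
    then have "(\<lambda>n. cmod (char P v) ^ n) \<longlonglongrightarrow> 0" by (intro LIMSEQ_power_zero) auto
    from order_tendstoD(2)[OF this, of "1/2"]
    have "\<forall>\<^sub>F n in sequentially. cmod (char P v) ^ n < 1 / 2" by simp
    with T(2) eventually_ge_at_top[of 1]
    have "\<forall>\<^sub>F n in sequentially. norm (T / a n - 0) < e"
    proof eventually_elim
      case (elim n)
      have an: "a n > 0" using a elim by simp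
      have "T < v * a n"
      proof (rule ccontr)
        assume "\<not> T < v * a n"
        then have "1 / 2 \<le> cmod (char P (v * a n / a n) ^ n)" using elim an v by (intro elim(1)[rule_format]) auto
        then show False using elim an by (simp add: norm_power)
      qed
      then have "T / a n < v" using an by (simp add: field_simps)
      then show ?case using v T(1) an by simp
    qed
    then show "\<exists>no. \<forall>n\<ge>no. norm (T / a n - 0) < e" by (simp add: eventually_sequentially)
  qed
  \<comment> \<open>The shift makes every term nonzero: positivity of \<open>a\<close> is known only
    from index 1 on.\<close>
  define b where "b n = t0 / a (Suc n)" for n
  have a_pos: "a (Suc n) > 0" for n using a by simp
  have b_ne: "b n \<noteq> 0" for n using t0(1) a_pos[of n] by (simp add: b_def)
  have "(\<lambda>n. t0 / T * (T / a n)) \<longlonglongrightarrow> t0 / T * 0" by (intro tendsto_intros inv_a)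
  then have "(\<lambda>n. t0 / a n) \<longlonglongrightarrow> 0" using T(1) by simp
  then have b0: "b \<longlonglongrightarrow> 0" unfolding b_def by (rule LIMSEQ_Suc)
  have quot: "(\<lambda>n. (1 - g (b n)) / (b n)\<^sup>2) \<longlonglongrightarrow> \<sigma>" by (rule g_quot[OF b0 b_ne])
  have "(\<lambda>n. (1 - g (b n)) / (b n)\<^sup>2 * (b n)\<^sup>2) \<longlonglongrightarrow> \<sigma> * 0\<^sup>2" by (intro tendsto_intros quot b0)
  then have g1: "(\<lambda>n. 1 - g (b n)) \<longlonglongrightarrow> 0" using b_ne by simp
  have glim': "(\<lambda>n. g (b n) ^ Suc n) \<longlonglongrightarrow> h" unfolding b_def by (rule LIMSEQ_Suc[OF glim])
  define y where "y n = - ln (g (b n) ^ Suc n)" for n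
  have y: "y \<longlonglongrightarrow> - ln h" unfolding y_def using h by (intro tendsto_intros glim') auto
  have ev: "\<forall>\<^sub>F n in sequentially. g (b n) > 0"
    using order_tendstoD(2)[OF g1, of 1] by (auto elim: eventually_mono)
  \<comment> \<open>The sandwich rests on \<open>- g * ln g \<le> 1 - g \<le> - ln g\<close> for
    \<open>g > 0\<close>. The lower factor \<open>1 - (1 - g (b n))\<close> is
    \<open>g (b n)\<close>, written so that its limit 1 is read off from \<open>g1\<close>.\<close>
  have "(\<lambda>n. real (Suc n) * (1 - g (b n))) \<longlonglongrightarrow> - ln h"
  proof (rule tendsto_sandwich)
    show "\<forall>\<^sub>F n in sequentially. real (Suc n) * (1 - g (b n)) \<le> y n"
      using ev
    proof eventually_elim
      case (elim n)
      have "real (Suc n) * (1 - g (b n)) \<le> real (Suc n) * (- ln (g (b n)))"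
        using ln_le_minus_one[OF elim] by (intro mult_left_mono) auto
      then show ?case unfolding y_def using elim by (subst ln_realpow) auto
    qed
    show "\<forall>\<^sub>F n in sequentially. y n * (1 - (1 - g (b n))) \<le> real (Suc n) * (1 - g (b n))"
      using ev
    proof eventually_elim
      case (elim n)
      have "- ln (g (b n)) \<le> 1 / g (b n) - 1"
        using ln_le_minus_one[of "1 / g (b n)"] elim by (simp add: ln_div)
      then have "- ln (g (b n)) * g (b n) \<le> 1 - g (b n)" using elim by (simp add: field_simps)
      then have "real (Suc n) * (- ln (g (b n)) * g (b n)) \<le> real (Suc n) * (1 - g (b n))"
        by (intro mult_left_mono) auto
      moreover have "y n = real (Suc n) * - ln (g (b n))" unfolding y_def using elim by (subst ln_realpow) auto
      ultimately show ?case by simp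
    qed
    show "(\<lambda>n. y n * (1 - (1 - g (b n)))) \<longlonglongrightarrow> - ln h"
      using tendsto_mult[OF y tendsto_diff[OF tendsto_const[of 1] g1]] by simp
  qed (rule y)
  then have "(\<lambda>n. real (Suc n) * (1 - g (b n)) / ((1 - g (b n)) / (b n)\<^sup>2)) \<longlonglongrightarrow> - ln h / \<sigma>"
    using \<open>\<sigma> > 0\<close> by (intro tendsto_divide quot) auto
  \<comment> \<open>Cancelling \<open>1 - g (b n)\<close> is legitimate only where it is nonzero,
    which holds eventually because the quotient tends to \<open>\<sigma> > 0\<close>.\<close>
  moreover have "\<forall>\<^sub>F n in sequentially.
      real (Suc n) * (1 - g (b n)) / ((1 - g (b n)) / (b n)\<^sup>2) = real (Suc n) * (b n)\<^sup>2"
    using order_tendstoD(1)[OF quot \<open>\<sigma> > 0\<close>] by eventually_elim auto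
  ultimately have "(\<lambda>n. real (Suc n) * (b n)\<^sup>2) \<longlonglongrightarrow> - ln h / \<sigma>"
    by (rule Lim_transform_eventually)
  then have "(\<lambda>n. t0 / sqrt (real (Suc n) * (b n)\<^sup>2)) \<longlonglongrightarrow> t0 / sqrt (- ln h / \<sigma>)"
    using h \<open>\<sigma> > 0\<close> by (intro tendsto_intros) auto
  moreover have "t0 / sqrt (real (Suc n) * (b n)\<^sup>2) = a (Suc n) / sqrt (real (Suc n))" for n
    using t0(1) a_pos[of n] by (simp add: real_sqrt_mult b_def real_sqrt_divide)
  ultimately have "(\<lambda>n. a (Suc n) / sqrt (real (Suc n))) \<longlonglongrightarrow> t0 / sqrt (- ln h / \<sigma>)" by simp
  then show ?thesis
    by (intro exI[of _ "t0 / sqrt (- ln h / \<sigma>)"]) (rule LIMSEQ_imp_Suc)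
qed

subsection \<open>Projections of the normalised sums\<close>

lemma char_distr:
  fixes f :: "'a \<Rightarrow> real"
  assumes "f \<in> borel_measurable M"
  shows "char (distr M borel f) t = (\<integral>x. iexp (t * f x) \<partial>M)"
  unfolding char_def by (subst integral_distr[OF assms]) auto

lemma borel_prob_distr:
  assumes "prob_space M" "f \<in> borel_measurable M"
  shows "borel_prob (distr M borel f)"
  using assms prob_space.prob_space_distr by (auto simp: borel_prob_def)

lemma real_distribution_distr:
  fixes f :: "'b::topological_space \<Rightarrow> real"
  assumes "borel_prob \<mu>" "continuous_on UNIV f"
  shows "real_distribution (distr \<mu> borel f)"
  using assms measurable_cong_sets[of \<mu> borel borel borel] borel_measurable_continuous_onI[of f]
  by (auto simp: borel_prob_def real_distribution_def real_distribution_axioms_def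
      intro!: prob_space.prob_space_distr)

lemma borel_prob_measurable:
  assumes "borel_prob \<mu>" "continuous_on UNIV f"
  shows "f \<in> borel_measurable \<mu>"
  using assms borel_measurable_continuous_onI[of f] by (metis borel_prob_def measurable_cong_sets)

text \<open>Weak convergence is tested on real functions, so the exponential is split into cosine
  and sine.\<close>

lemma weakly_converges_char:
  fixes f :: "'b::metric_space \<Rightarrow> real"
  assumes \<mu>: "\<And>n. borel_prob (\<mu> n)" and \<nu>: "borel_prob \<nu>" and conv: "weakly_converges \<mu> \<nu>"
    and f: "continuous_on UNIV f"
  shows "(\<lambda>n. char (distr (\<mu> n) borel f) t) \<longlonglongrightarrow> char (distr \<nu> borel f) t"
proof -
  have eq: "char (distr N borel f) t = Complex (\<integral>x. cos (t * f x) \<partial>N) (\<integral>x. sin (t * f x) \<partial>N)"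
    if N: "borel_prob N" for N :: "'b measure"
  proof -
    interpret prob_space N using N by (simp add: borel_prob_def)
    have "complex_integrable N (\<lambda>x. iexp (t * f x))"
      using borel_prob_measurable[OF N f] by (intro integrable_iexp) auto
    then show ?thesis
      by (subst char_distr[OF borel_prob_measurable[OF N f]], intro complex_eqI)
         (simp_all add: Re_exp Im_exp flip: integral_Re integral_Im)
  qed
  show ?thesis
    unfolding eq[OF \<mu>] eq[OF \<nu>]
    by (intro tendsto_Complex weakly_convergesD[OF conv, of _ 1] continuous_on_cos continuous_on_sin
        continuous_on_mult_left f) auto
qed

text \<open>One test function \<open>min 2 \<bar>T * f x\<bar>\<close> controls all \<open>t\<close>
  with \<open>\<bar>t\<bar> \<le> T\<close> at once. Its integral under the limit is below
  \<open>1 / 2\<close> for small \<open>T\<close> by dominated convergence, and weak convergence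
  passes this to all large \<open>n\<close>.\<close>

lemma weakly_converges_char_lower_bound:
  fixes f :: "'b::topological_space \<Rightarrow> real"
  assumes \<mu>: "\<And>n. borel_prob (\<mu> n)" and \<nu>: "borel_prob \<nu>" and conv: "weakly_converges \<mu> \<nu>"
    and f: "continuous_on UNIV f"
  obtains T where "T > 0"
    "\<forall>\<^sub>F n in sequentially. \<forall>t. \<bar>t\<bar> \<le> T \<longrightarrow> 1 / 2 \<le> cmod (char (distr (\<mu> n) borel f) t)"
proof -
  define w where "w T x = min 2 \<bar>T * f x\<bar>" for T x
  have w: "continuous_on UNIV (w T)" "\<bar>w T x\<bar> \<le> 2" for T x
    unfolding w_def by (auto intro!: continuous_intros f)
  define r where "r k = inverse (real (Suc k))" for k
  interpret \<nu>: prob_space \<nu> using \<nu> by (simp add: borel_prob_def)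
  have "(\<lambda>k. \<integral>x. w (r k) x \<partial>\<nu>) \<longlonglongrightarrow> (\<integral>x. 0 \<partial>\<nu>)"
  proof (rule integral_dominated_convergence[where w = "\<lambda>_. 2"])
    show "AE x in \<nu>. (\<lambda>k. w (r k) x) \<longlonglongrightarrow> 0"
    proof (rule AE_I2)
      fix x
      have "(\<lambda>k. w (r k) x) \<longlonglongrightarrow> min 2 \<bar>0 * f x\<bar>"
        unfolding w_def r_def by (intro tendsto_intros LIMSEQ_inverse_real_of_nat)
      then show "(\<lambda>k. w (r k) x) \<longlonglongrightarrow> 0" by simp
    qed
  qed (use w(2) borel_prob_measurable[OF \<nu> w(1)] in auto)
  then have "\<forall>\<^sub>F k in sequentially. (\<integral>x. w (r k) x \<partial>\<nu>) < 1 / 2"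
    by (intro order_tendstoD(2)[of _ 0]) auto
  then obtain k where k: "(\<integral>x. w (r k) x \<partial>\<nu>) < 1 / 2" by (auto simp: eventually_sequentially)
  show thesis
  proof (rule that)
    show "r k > 0" by (simp add: r_def)
    show "\<forall>\<^sub>F n in sequentially. \<forall>t. \<bar>t\<bar> \<le> r k \<longrightarrow> 1 / 2 \<le> cmod (char (distr (\<mu> n) borel f) t)"
      using order_tendstoD(2)[OF weakly_convergesD[OF conv w] k]
    proof eventually_elim
      case (elim n)
      interpret \<mu>: prob_space "\<mu> n" using \<mu> by (simp add: borel_prob_def)
      interpret D: real_distribution "distr (\<mu> n) borel f" by (rule real_distribution_distr[OF \<mu> f])
      show ?case
      proof (intro allI impI)
        fix t assume t: "\<bar>t\<bar> \<le> r k"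
        have "1 - cmod (char (distr (\<mu> n) borel f) t) \<le> (\<integral>x. w t x \<partial>\<mu> n)"
          using D.one_minus_norm_char_le[of t] borel_prob_measurable[OF \<mu> f]
          by (subst (asm) integral_distr) (auto simp: w_def)
        also have "\<dots> \<le> (\<integral>x. w (r k) x \<partial>\<mu> n)"
        proof (rule integral_mono)
          fix x
          have "\<bar>t\<bar> * \<bar>f x\<bar> \<le> r k * \<bar>f x\<bar>" using t by (intro mult_right_mono) auto
          then show "w t x \<le> w (r k) x" using \<open>r k > 0\<close> by (auto simp: w_def abs_mult)
        qed (auto intro!: borel_prob_integrable[OF \<mu>] w)
        finally show "1 / 2 \<le> cmod (char (distr (\<mu> n) borel f) t)" using elim by linarith
      qed
    qed
  qed
qed

lemma borel_measurable_psum: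
  fixes X :: "'a \<Rightarrow> 'b::{banach, second_countable_topology}"
  assumes "prob_space M" "iid_copies M X Xs"
  shows "psum Xs n \<in> borel_measurable M"
proof -
  have "Xs i \<in> borel_measurable M" if "i \<in> {1..n}" for i
    using assms that by (auto simp: iid_copies_def prob_space.indep_vars_def)
  then show ?thesis unfolding psum_def by (intro borel_measurable_sum) auto
qed

lemma borel_prob_scaled_law:
  fixes X :: "'a \<Rightarrow> 'b::{banach, second_countable_topology}"
  assumes "prob_space M" "iid_copies M X Xs"
  shows "borel_prob (scaled_law M Xs a n)"
  unfolding scaled_law_def using borel_measurable_psum[OF assms]
  by (intro borel_prob_distr[OF assms(1)]) auto

text \<open>Linearity moves \<open>f\<close> inside the sum and the scaling into the argument;
  independence gives the power. The right side depends only on the law of \<open>X\<close>, so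
  different choices of copies can be compared.\<close>

lemma char_scaled_law:
  fixes X :: "'a \<Rightarrow> 'b::{banach, second_countable_topology}" and f :: "'b \<Rightarrow> real"
  assumes M: "prob_space M" and X: "X \<in> borel_measurable M" and iid: "iid_copies M X Xs"
    and f: "bounded_linear f"
  shows "char (distr (scaled_law M Xs a n) borel f) t = char (distr M borel (\<lambda>\<omega>. f (X \<omega>))) (t / a n) ^ n"
proof -
  interpret prob_space M by fact
  interpret f: bounded_linear f by fact
  have f_meas[measurable]: "f \<in> borel_measurable borel"
    by (intro borel_measurable_continuous_onI f.continuous_on continuous_on_id)
  have psum[measurable]: "psum Xs n \<in> borel_measurable M" by (rule borel_measurable_psum[OF M iid])
  have Xs: "Xs i \<in> borel_measurable M" if "i \<ge> 1" for i
    using iid that by (auto simp: iid_copies_def indep_vars_def)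
  have "indep_vars (\<lambda>_. borel) (\<lambda>i \<omega>. f (Xs i \<omega>)) {1..n}"
    using iid indep_vars_compose2[of "\<lambda>_. borel" Xs "{1..}" "\<lambda>_. f" "\<lambda>_. borel"]
    by (auto simp: iid_copies_def intro: indep_vars_subset)
  from char_distr_sum[OF this, of "t / a n"]
  have sum: "char (distr M borel (\<lambda>\<omega>. \<Sum>i=1..n. f (Xs i \<omega>))) (t / a n) =
      (\<Prod>i=1..n. char (distr M borel (\<lambda>\<omega>. f (Xs i \<omega>))) (t / a n))" .
  have "distr M borel (\<lambda>\<omega>. f (Xs i \<omega>)) = distr M borel (\<lambda>\<omega>. f (X \<omega>))" if "i \<ge> 1" for i
  proof -
    have "distr (distr M borel (Xs i)) borel f = distr (distr M borel X) borel f"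
      using iid that by (simp add: iid_copies_def)
    then show ?thesis using Xs[OF that] X by (simp add: distr_distr comp_def)
  qed
  then have "(\<Prod>i=1..n. char (distr M borel (\<lambda>\<omega>. f (Xs i \<omega>))) (t / a n)) =
      char (distr M borel (\<lambda>\<omega>. f (X \<omega>))) (t / a n) ^ n"
    by simp
  moreover have "char (distr (scaled_law M Xs a n) borel f) t =
      char (distr M borel (\<lambda>\<omega>. f (psum Xs n \<omega>))) (t / a n)"
    unfolding scaled_law_def
    by (simp add: distr_distr comp_def char_distr f.scaleR divide_inverse mult.assoc)
  moreover have "f (psum Xs n \<omega>) = (\<Sum>i=1..n. f (Xs i \<omega>))" for \<omega> by (simp add: psum_def f.sum)
  ultimately show ?thesis using sum by simp
qed

section \<open>Conclusion: convergence under the square-root norming\<close>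

theorem theorem2:
  fixes M :: "'a measure"
    and X :: "'a \<Rightarrow> 'b::{banach, second_countable_topology}"
    and Xs :: "nat \<Rightarrow> 'a \<Rightarrow> 'b"
    and a :: "nat \<Rightarrow> real"
  assumes "prob_space M"
    and "X \<in> borel_measurable M"
    and "CLTSS M X"
    and "\<not> CLT M X"
    and "iid_copies M X Xs"
    and "\<And>n. n \<ge> 1 \<Longrightarrow> a n > 0"
  shows "\<not> (\<exists>\<nu>. borel_prob \<nu> \<and> nondegenerate \<nu> \<and> weakly_converges (scaled_law M Xs a) \<nu>)"
proof
  assume "\<exists>\<nu>. borel_prob \<nu> \<and> nondegenerate \<nu> \<and> weakly_converges (scaled_law M Xs a) \<nu>"
  then obtain \<nu> where \<nu>: "borel_prob \<nu>" "nondegenerate \<nu>" "weakly_converges (scaled_law M Xs a) \<nu>"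
    by blast
  note M = assms(1) and X = assms(2) and iid = assms(5) and a = assms(6)
  note law = borel_prob_scaled_law[OF M iid]
  \<comment> \<open>The copies witnessing \<open>CLTSS\<close> may differ from \<open>Xs\<close>;
    both enter below only through \<open>char P\<close>.\<close>
  obtain Ys m \<mu> where Ys: "iid_copies M X Ys" and m: "strict_mono m" "\<And>n. m n \<ge> 1"
    and \<mu>: "borel_prob \<mu>" "weakly_converges (\<lambda>k. scaled_law M Ys (\<lambda>k. sqrt (real k)) (m k)) \<mu>"
    using assms(3) unfolding CLTSS_def by blast
  obtain f :: "'b \<Rightarrow> real" where f: "bounded_linear f" "\<And>c. \<not> (AE x in \<nu>. f x = c)"
    using nondegenerate_functional[OF \<nu>(1,2)] by metis
  have cont: "continuous_on UNIV f"
    by (intro bounded_linear.continuous_on[OF f(1)] continuous_on_id)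
  define P where "P = distr M borel (\<lambda>\<omega>. f (X \<omega>))"
  have char_P: "char (distr (scaled_law M Zs c n) borel f) t = char P (t / c n) ^ n"
    if "iid_copies M X Zs" for Zs c n t
    unfolding P_def by (rule char_scaled_law[OF M X that f(1)])
  obtain R where R: "R > 0" "\<forall>\<^sub>F k in sequentially. \<forall>t. \<bar>t\<bar> \<le> R \<longrightarrow>
      1 / 2 \<le> cmod (char P (t / sqrt (real (m k))) ^ m k)"
    by (rule weakly_converges_char_lower_bound
        [OF borel_prob_scaled_law[OF M Ys] \<mu> cont, unfolded char_P[OF Ys]])
  obtain T where T: "T > 0" "\<forall>\<^sub>F n in sequentially. \<forall>t. \<bar>t\<bar> \<le> T \<longrightarrow>
      1 / 2 \<le> cmod (char P (t / a n) ^ n)"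
    by (rule weakly_converges_char_lower_bound[OF law \<nu>(1,3) cont, unfolded char_P[OF iid]])
  have "\<exists>c. (\<lambda>n. a n / sqrt (real n)) \<longlonglongrightarrow> c"
  proof (rule norming_sequence_convergent[OF _ _ m R a T])
    show "real_distribution P"
      using real_distribution_distr[OF borel_prob_distr[OF M X] cont] X borel_measurable_continuous_onI[OF cont]
      by (simp add: P_def distr_distr comp_def)
    show "real_distribution (distr \<nu> borel f)" by (rule real_distribution_distr[OF \<nu>(1) cont])
    show "(\<lambda>n. char P (t / a n) ^ n) \<longlonglongrightarrow> char (distr \<nu> borel f) t" for t
      using weakly_converges_char[OF law \<nu>(1,3) cont, of t] unfolding char_P[OF iid] .
    show "\<not> (AE x in distr \<nu> borel f. x = c)" for c
      using f(2)[of c] borel_prob_measurable[OF \<nu>(1) cont] by (subst AE_distr_iff) auto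
  qed
  then obtain c where c: "(\<lambda>n. a n / sqrt (real n)) \<longlonglongrightarrow> c" by blast
  have scaled: "distr (scaled_law M Xs a n) borel (\<lambda>x. (a n / sqrt (real n)) *\<^sub>R x) =
      scaled_law M Xs (\<lambda>n. sqrt (real n)) n" if "n \<ge> 1" for n
  proof -
    have "a n / sqrt (real n) * inverse (a n) = inverse (sqrt (real n))"
      using a[OF that] by (simp add: field_simps)
    then show ?thesis
      using borel_measurable_psum[OF M iid, of n] by (simp add: scaled_law_def distr_distr comp_def)
  qed
  have "weakly_converges (scaled_law M Xs (\<lambda>n. sqrt (real n))) (distr \<nu> borel (\<lambda>x. c *\<^sub>R x))"
    unfolding weakly_converges_def
  proof (intro allI impI)
    fix g :: "'b \<Rightarrow> real" assume "continuous_on UNIV g \<and> bounded (range g)"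
    then have "(\<lambda>n. \<integral>x. g x \<partial>distr (scaled_law M Xs a n) borel (\<lambda>x. (a n / sqrt (real n)) *\<^sub>R x))
        \<longlonglongrightarrow> (\<integral>x. g x \<partial>distr \<nu> borel (\<lambda>x. c *\<^sub>R x))"
      using weakly_converges_scaleR[OF law \<nu>(1,3) c] unfolding weakly_converges_def by blast
    \<comment> \<open>The rescaled laws agree with the square-root-normed ones only for
      \<open>n \<ge> 1\<close>, so the limit is transferred along an eventual equality.\<close>
    then show "(\<lambda>n. \<integral>x. g x \<partial>scaled_law M Xs (\<lambda>n. sqrt (real n)) n) \<longlonglongrightarrow> (\<integral>x. g x \<partial>distr \<nu> borel (\<lambda>x. c *\<^sub>R x))"
      by (rule Lim_transform_eventually) (use scaled in \<open>auto simp: eventually_sequentially intro!: exI[of _ 1]\<close>)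
  qed
  moreover have "borel_prob (distr \<nu> borel (\<lambda>x. c *\<^sub>R x))"
    using \<nu>(1) by (intro borel_prob_distr borel_prob_measurable[OF \<nu>(1)] continuous_intros)
      (auto simp: borel_prob_def)
  ultimately have "CLT M X" using iid unfolding CLT_def by blast
  then show False using assms(4) by blast
qed

end
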